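(* Let $\psi\colon\mathbb{N}\to(0,1]$ be a decreasing function, let $N\ge 1$ be an integer, and let $\sigma\in\mathcal{L}_{up}^*(\psi,N)$. Suppose there is a differentiable, non-negative function $\vartheta\colon\mathbb{R}^+\to\mathbb{R}$ with non-constant derivative $\vartheta'$ such that (i) $\vartheta'$ is increasing for $x\ge 1$, (ii) $e\,\psi(x)\,\vartheta(x)\le\vartheta'(x)$ for all $x\in\mathbb{N}$ with $x\ge N$, and (iii) $\vartheta'(1)\ge 1$. Then, as $n\to\infty$, $$\mathbb{E}(H_{n,\sigma})\le \bigl(\ln\vartheta'(n)\bigr)\,(1+o(1)).$$
   Context: $\mathbb{N}=\{1,2,3,\dots\}$; $\mathbb{R}^+$ is the set of positive reals; $\ln$ is the natural logarithm and $e$ is Euler's number. "Increasing" and "decreasing" are meant in the non-strict sense. Binary trees: $\mathcal{T}$ is the set of full binary trees, i.e. rooted ordered trees in which each node has either exactly two children (a left and a right one) or none. The size $|t|$ of $t\in\mathcal{T}$ is its number of leaves, and $\mathcal{T}_n$ is the set of $t\in\mathcal{T}$ with $|t|=n$. For $|t|\ge 2$, $t_\ell$ and $t_r$ denote the left and right subtrees at the root. The height is $h(t)=0$ if $|t|=1$ and $h(t)=1+\max(h(t_\ell),h(t_r))$ otherwise. Leaf-centric tree sources: $\mathcal{L}$ is the set of all functions $\sigma\colon\mathbb{N}\times\mathbb{N}\to[0,1]$ with $\sum_{i=1}^{k-1}\sigma(i,k-i)=1$ for every integer $k\ge 2$. For $\sigma\in\mathcal{L}$ define $P_\sigma\colon\mathcal{T}\to[0,1]$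 by $P_\sigma(t)=1$ if $|t|=1$ and $P_\sigma(t)=\sigma(|t_\ell|,|t_r|)\cdot P_\sigma(t_\ell)\cdot P_\sigma(t_r)$ otherwise. For every $n\ge1$, $P_\sigma$ restricted to $\mathcal{T}_n$ is a probability mass function. $H_{n,\sigma}$ denotes the height of a random tree drawn from $\mathcal{T}_n$ according to $P_\sigma$, so $\mathbb{E}(H_{n,\sigma})=\sum_{t\in\mathcal{T}_n}P_\sigma(t)h(t)$. Upper-bounded sources: $\mathcal{L}_{up}^*(\psi,N)$ is the set of all $\sigma\in\mathcal{L}$ such that $\sigma(i,n-i)+\sigma(n-i,i)\le\psi(n)$ for all integers $n\ge N$ and $1\le i\le n-1$. An inequality $a_n\le b_n(1+o(1))$ means that there is a real sequence $\varepsilon_n\to0$ with $a_n\le b_n(1+\varepsilon_n)$ for all sufficiently large $n$ (with $\sigma,\psi,N,\vartheta$ fixed). *)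

theory Defs
  imports "HOL-Analysis.Analysis" "HOL-Library.Tree"
begin

text \<open>
  A full binary tree is a \<^typ>\<open>unit tree\<close>: \<^const>\<open>Leaf\<close> is the one-node tree (a leaf of the full
  binary tree), and \<^term>\<open>Node l () r\<close> is a root with exactly two children. The number of leaves
  is thus \<^const>\<open>size1\<close> (not \<^const>\<open>size\<close>, which counts inner nodes).
\<close>
type_synonym full_tree = "unit tree"

definition trees_of_size :: "nat \<Rightarrow> full_tree set" where
  "trees_of_size n = {t. size1 t = n}"

text \<open>
  The domain of a source is pairs of positive integers; values at arguments 0 are left
  unconstrained and are never used, since \<^const>\<open>size1\<close> is always positive.
\<close>
definition leaf_centric_sources :: "(nat \<Rightarrow> nat \<Rightarrow> real) set" where
  "leaf_centric_sources =
     {\<sigma>. (\<forall>i\<ge>1. \<forall>j\<ge>1. \<sigma> i j \<in> {0..1}) \<and>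
         (\<forall>k\<ge>2. (\<Sum>i=1..k-1. \<sigma> i (k - i)) = 1)}"

definition upper_bounded_sources :: "(nat \<Rightarrow> real) \<Rightarrow> nat \<Rightarrow> (nat \<Rightarrow> nat \<Rightarrow> real) set" where
  "upper_bounded_sources \<psi> N =
     {\<sigma> \<in> leaf_centric_sources. \<forall>n\<ge>N. \<forall>i\<in>{1..n-1}. \<sigma> i (n - i) + \<sigma> (n - i) i \<le> \<psi> n}"

fun tree_prob :: "(nat \<Rightarrow> nat \<Rightarrow> real) \<Rightarrow> full_tree \<Rightarrow> real" where
  "tree_prob \<sigma> Leaf = 1"
| "tree_prob \<sigma> (Node l _ r) = \<sigma> (size1 l) (size1 r) * tree_prob \<sigma> l * tree_prob \<sigma> r"

definition expected_height :: "(nat \<Rightarrow> nat \<Rightarrow> real) \<Rightarrow> nat \<Rightarrow> real" where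
  "expected_height \<sigma> n = (\<Sum>t\<in>trees_of_size n. tree_prob \<sigma> t * real (height t))"

lemma trees_of_size_1: "trees_of_size 1 = {Leaf}"
  by (auto simp: trees_of_size_def size1_size)

lemma trees_of_size_rec:
  assumes "n \<ge> 2"
  shows "trees_of_size n =
    (\<Union>i\<in>{1..n-1}. (\<lambda>(l, r). Node l () r) ` (trees_of_size i \<times> trees_of_size (n - i)))"
    (is "_ = ?R")
proof
  show "trees_of_size n \<subseteq> ?R"
  proof
    fix t assume t: "t \<in> trees_of_size n"
    with assms obtain l r where lr: "t = Node l () r"
      by (cases t) (auto simp: trees_of_size_def)
    with t have "size1 l \<in> {1..n-1}" "l \<in> trees_of_size (size1 l)"
      "r \<in> trees_of_size (n - size1 l)"
      by (auto simp: trees_of_size_def size1_size)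
    then show "t \<in> ?R" using lr by force
  qed
qed (auto simp: trees_of_size_def)

lemma finite_trees_of_size: "finite (trees_of_size n)"
proof (induction n rule: less_induct)
  case (less n)
  consider "n = 0" | "n = 1" | "n \<ge> 2" by linarith
  then show ?case
  proof cases
    case 1
    then show ?thesis by (simp add: trees_of_size_def size1_size)
  next
    case 2
    then show ?thesis by (simp add: trees_of_size_1 del: One_nat_def)
  next
    case 3
    then show ?thesis by (auto simp: trees_of_size_rec intro!: finite_imageI finite_cartesian_product less)
  qed
qed

text \<open>\<^const>\<open>tree_prob\<close> is a probability mass function on the trees of each given size.\<close>

lemma tree_prob_nonneg:
  assumes "\<sigma> \<in> leaf_centric_sources"
  shows "tree_prob \<sigma> t \<ge> 0"
proof (induction t)
  case (Node l x r)
  have "size1 l \<ge> 1" "size1 r \<ge> 1" by (simp_all add: size1_size)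
  then have "\<sigma> (size1 l) (size1 r) \<ge> 0" using assms by (auto simp: leaf_centric_sources_def)
  with Node show ?case by simp
qed simp

lemma sum_tree_prob:
  assumes \<sigma>: "\<sigma> \<in> leaf_centric_sources" and "n \<ge> 1"
  shows "(\<Sum>t\<in>trees_of_size n. tree_prob \<sigma> t) = 1"
  using \<open>n \<ge> 1\<close>
proof (induction n rule: less_induct)
  case (less n)
  show ?case
  proof (cases "n = 1")
    case True
    then show ?thesis by (simp add: trees_of_size_1 del: One_nat_def)
  next
    case False
    with less.prems have n: "n \<ge> 2" by simp
    let ?A = "\<lambda>i. trees_of_size i \<times> trees_of_size (n - i)"
    let ?f = "\<lambda>(l, r). Node l () r"
    have "(\<Sum>t\<in>trees_of_size n. tree_prob \<sigma> t) = (\<Sum>i=1..n-1. \<Sum>t\<in>?f ` ?A i. tree_prob \<sigma> t)"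
      unfolding trees_of_size_rec[OF n]
    proof (rule sum.UNION_disjoint)
      show "\<forall>i\<in>{1..n-1}. finite (?f ` ?A i)"
        by (intro ballI finite_imageI finite_cartesian_product finite_trees_of_size)
    qed (auto simp: trees_of_size_def)
    also have "\<dots> = (\<Sum>i=1..n-1. \<sigma> i (n - i))"
    proof (rule sum.cong)
      fix i assume i: "i \<in> {1..n-1}"
      have "(\<Sum>t\<in>?f ` ?A i. tree_prob \<sigma> t) = (\<Sum>p\<in>?A i. tree_prob \<sigma> (?f p))"
        by (subst sum.reindex) (auto simp: inj_on_def)
      also have "\<dots> = (\<Sum>(l, r)\<in>?A i. \<sigma> i (n - i) * (tree_prob \<sigma> l * tree_prob \<sigma> r))"
        by (rule sum.cong) (auto simp: trees_of_size_def)
      also have "\<dots> = \<sigma> i (n - i) * ((\<Sum>l\<in>trees_of_size i. tree_prob \<sigma> l) *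
                         (\<Sum>r\<in>trees_of_size (n - i). tree_prob \<sigma> r))"
        by (subst sum_product, subst sum.cartesian_product)
           (simp add: case_prod_unfold sum_distrib_left)
      also have "\<dots> = \<sigma> i (n - i)"
        using i less.IH[of i] less.IH[of "n - i"] by auto
      finally show "(\<Sum>t\<in>?f ` ?A i. tree_prob \<sigma> t) = \<sigma> i (n - i)" .
    qed simp
    also have "\<dots> = 1" using \<sigma> n by (auto simp: leaf_centric_sources_def)
    finally show ?thesis .
  qed
qed

end

theory Submission
  imports Defs
begin

text \<open>
  Let \<open>F n\<close> be the expected value of the sum of \<open>e\<close> to the power of the depth, over all leaves of a
  random tree with \<open>n\<close> leaves. Splitting at the root gives \<open>F n \<le> e \<psi>(n) (F 1 + \<dots> + F (n-1))\<close> for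
  \<open>n \<ge> N\<close>, while the convexity of \<open>\<theta>\<close> gives \<open>\<theta>'(1) + \<dots> + \<theta>'(n-1) \<le> \<theta>(n)\<close>, so that (ii) yields
  \<open>F n \<le> C \<theta>'(n)\<close> by induction. A deepest leaf alone contributes \<open>e\<close> to the power of the height to
  the sum, hence by Jensen's inequality the expected height is at most \<open>ln C + ln (\<theta>' n)\<close>.
  As a binary tree with \<open>n\<close> leaves has height at least \<open>log\<^sub>2 n\<close>, the same bound shows that
  \<open>ln (\<theta>' n)\<close> tends to infinity and absorbs the constant.
\<close>

text \<open>This is the sum of \<open>z ^ d\<close> over all leaves, \<open>d\<close> being the
  depth of the leaf: passing to the parent raises every depth by one, hence the factor
  \<open>z\<close>.\<close>

fun leaf_weight :: "real \<Rightarrow> full_tree \<Rightarrow> real" where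
  "leaf_weight z Leaf = 1"
| "leaf_weight z (Node l _ r) = z * (leaf_weight z l + leaf_weight z r)"

definition expected_leaf_weight :: "(nat \<Rightarrow> nat \<Rightarrow> real) \<Rightarrow> real \<Rightarrow> nat \<Rightarrow> real" where
  "expected_leaf_weight \<sigma> z n = (\<Sum>t\<in>trees_of_size n. tree_prob \<sigma> t * leaf_weight z t)"

lemma leaf_weight_nonneg: "z \<ge> 0 \<Longrightarrow> leaf_weight z t \<ge> 0"
  by (induction t) auto

text \<open>Dropping the nonnegative weight of the lower child at every node leaves the contribution
  of a single deepest leaf.\<close>

lemma power_height_le_leaf_weight:
  assumes "z \<ge> 0"
  shows "z ^ height t \<le> leaf_weight z t"
proof (induction t)
  case (Node l x r)
  have "z ^ max (height l) (height r) \<le> leaf_weight z l + leaf_weight z r"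
    using Node leaf_weight_nonneg[OF assms, of l] leaf_weight_nonneg[OF assms, of r]
    by (cases "height l \<le> height r") (auto simp: max_def)
  then show ?case using assms by (simp add: mult_left_mono)
qed simp

lemma sum_trees_of_size_rec:
  fixes f :: "full_tree \<Rightarrow> real"
  assumes "n \<ge> 2"
  shows "(\<Sum>t\<in>trees_of_size n. f t) =
    (\<Sum>i=1..n-1. \<Sum>l\<in>trees_of_size i. \<Sum>r\<in>trees_of_size (n - i). f (Node l () r))"
proof -
  let ?A = "\<lambda>i. trees_of_size i \<times> trees_of_size (n - i)"
  let ?f = "\<lambda>(l, r). Node l () r"
  have "(\<Sum>t\<in>trees_of_size n. f t) = (\<Sum>i=1..n-1. \<Sum>t\<in>?f ` ?A i. f t)"
    unfolding trees_of_size_rec[OF assms]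
  proof (rule sum.UNION_disjoint)
    show "\<forall>i\<in>{1..n-1}. finite (?f ` ?A i)"
      by (intro ballI finite_imageI finite_cartesian_product finite_trees_of_size)
  qed (auto simp: trees_of_size_def)
  also have "\<dots> = (\<Sum>i=1..n-1. \<Sum>p\<in>?A i. f (?f p))"
    by (intro sum.cong refl, subst sum.reindex) (auto simp: inj_on_def)
  also have "\<dots> = (\<Sum>i=1..n-1. \<Sum>l\<in>trees_of_size i. \<Sum>r\<in>trees_of_size (n - i). f (Node l () r))"
    by (simp add: sum.cartesian_product case_prod_unfold)
  finally show ?thesis .
qed

text \<open>Given the sizes at the root, the two subtrees are independent, so each adds its own
  expected weight times the total probability 1 of the other.\<close>

lemma expected_leaf_weight_rec:
  assumes \<sigma>: "\<sigma> \<in> leaf_centric_sources" and n: "n \<ge> 2"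
  shows "expected_leaf_weight \<sigma> z n =
    z * (\<Sum>i=1..n-1. (\<sigma> i (n - i) + \<sigma> (n - i) i) * expected_leaf_weight \<sigma> z i)"
proof -
  let ?F = "expected_leaf_weight \<sigma> z"
  let ?p = "tree_prob \<sigma>"
  have "?F n = (\<Sum>i=1..n-1. \<Sum>l\<in>trees_of_size i. \<Sum>r\<in>trees_of_size (n - i).
      ?p (Node l () r) * leaf_weight z (Node l () r))"
    unfolding expected_leaf_weight_def by (rule sum_trees_of_size_rec[OF n])
  also have "\<dots> = (\<Sum>i=1..n-1. z * (\<sigma> i (n - i) * (?F i + ?F (n - i))))"
  proof (rule sum.cong)
    fix i assume i: "i \<in> {1..n-1}"
    let ?L = "trees_of_size i" and ?R = "trees_of_size (n - i)"
    have "(\<Sum>l\<in>?L. \<Sum>r\<in>?R. ?p (Node l () r) * leaf_weight z (Node l () r))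
        = (\<Sum>l\<in>?L. \<Sum>r\<in>?R. z * \<sigma> i (n - i) * ((?p l * leaf_weight z l) * ?p r)
            + z * \<sigma> i (n - i) * (?p l * (?p r * leaf_weight z r)))"
      by (intro sum.cong refl) (auto simp: trees_of_size_def algebra_simps)
    also have "\<dots> = z * \<sigma> i (n - i) * (?F i * (\<Sum>r\<in>?R. ?p r))
        + z * \<sigma> i (n - i) * ((\<Sum>l\<in>?L. ?p l) * ?F (n - i))"
      unfolding expected_leaf_weight_def sum_product by (simp add: sum.distrib sum_distrib_left)
    also have "\<dots> = z * (\<sigma> i (n - i) * (?F i + ?F (n - i)))"
    proof -
      have "i \<ge> 1" "n - i \<ge> 1" using i by auto
      then show ?thesis by (simp add: sum_tree_prob[OF \<sigma>] algebra_simps)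
    qed
    finally show "(\<Sum>l\<in>?L. \<Sum>r\<in>?R. ?p (Node l () r) * leaf_weight z (Node l () r))
        = z * (\<sigma> i (n - i) * (?F i + ?F (n - i)))" .
  qed simp
  also have "\<dots> = z * ((\<Sum>i=1..n-1. \<sigma> i (n - i) * ?F i) + (\<Sum>i=1..n-1. \<sigma> i (n - i) * ?F (n - i)))"
    by (simp add: sum_distrib_left sum.distrib distrib_left)
  \<comment> \<open>Reflecting \<open>i\<close> to \<open>n - i\<close> turns the right subtrees
    into left ones and so produces the symmetric sum of \<open>\<sigma>\<close> that
    \<open>\<psi>\<close> bounds.\<close>
  also have "(\<Sum>i=1..n-1. \<sigma> i (n - i) * ?F (n - i)) = (\<Sum>i=1..n-1. \<sigma> (n - i) i * ?F i)"
    by (rule sum.reindex_bij_witness[where i = "\<lambda>i. n - i" and j = "\<lambda>i. n - i"]) auto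
  finally show ?thesis by (simp add: sum.distrib distrib_right)
qed

lemma expected_leaf_weight_nonneg:
  assumes "\<sigma> \<in> leaf_centric_sources" "z \<ge> 0"
  shows "expected_leaf_weight \<sigma> z n \<ge> 0"
  unfolding expected_leaf_weight_def
  by (intro sum_nonneg mult_nonneg_nonneg tree_prob_nonneg leaf_weight_nonneg assms)

text \<open>Jensen's inequality by way of the tangent to \<open>exp\<close> at the mean
  \<open>\<mu>\<close>: its linear term averages to zero, and it lies below \<open>exp\<close> at
  every height.\<close>

lemma exp_expected_height_le:
  assumes \<sigma>: "\<sigma> \<in> leaf_centric_sources" and n: "n \<ge> 1"
  shows "exp (expected_height \<sigma> n) \<le> expected_leaf_weight \<sigma> (exp 1) n"
proof -
  let ?T = "trees_of_size n" and ?p = "tree_prob \<sigma>"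
  define \<mu> where "\<mu> = expected_height \<sigma> n"
  have total: "(\<Sum>t\<in>?T. ?p t) = 1" by (rule sum_tree_prob[OF \<sigma> n])
  \<comment> \<open>The bracket is \<open>\<mu> + (1 - \<mu>) * 1 = 1\<close>, written as a sum over
    trees to expose the tangent.\<close>
  have "exp \<mu> = exp \<mu> * ((\<Sum>t\<in>?T. ?p t * real (height t)) + (1 - \<mu>) * (\<Sum>t\<in>?T. ?p t))"
    unfolding total by (simp add: \<mu>_def expected_height_def)
  also have "\<dots> = (\<Sum>t\<in>?T. ?p t * (exp \<mu> * (1 + (real (height t) - \<mu>))))"
    by (simp add: sum_distrib_left sum.distrib[symmetric] algebra_simps)
  also have "\<dots> \<le> (\<Sum>t\<in>?T. ?p t * leaf_weight (exp 1) t)"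
  proof (intro sum_mono mult_left_mono tree_prob_nonneg[OF \<sigma>])
    fix t :: full_tree
    have "exp \<mu> * (1 + (real (height t) - \<mu>)) \<le> exp \<mu> * exp (real (height t) - \<mu>)"
      by (intro mult_left_mono exp_ge_add_one_self) simp
    also have "\<dots> = exp 1 ^ height t"
      by (simp flip: exp_add exp_of_nat_mult)
    also have "\<dots> \<le> leaf_weight (exp 1) t"
      by (rule power_height_le_leaf_weight) simp
    finally show "exp \<mu> * (1 + (real (height t) - \<mu>)) \<le> leaf_weight (exp 1) t" .
  qed
  finally show ?thesis by (simp add: \<mu>_def expected_leaf_weight_def)
qed

text \<open>A tree of height \<open>h\<close> has at most \<open>2 ^ h\<close> leaves, so the bound
  holds for each tree and survives averaging.\<close>

lemma log2_le_expected_height: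
  assumes \<sigma>: "\<sigma> \<in> leaf_centric_sources" and n: "n \<ge> 1"
  shows "log 2 (real n) \<le> expected_height \<sigma> n"
proof -
  have "log 2 (real n) = (\<Sum>t\<in>trees_of_size n. tree_prob \<sigma> t * log 2 (real n))"
    by (simp add: sum_tree_prob[OF \<sigma> n] flip: sum_distrib_right)
  also have "\<dots> \<le> expected_height \<sigma> n"
    unfolding expected_height_def
  proof (intro sum_mono mult_left_mono tree_prob_nonneg[OF \<sigma>])
    fix t assume "t \<in> trees_of_size n"
    then have "n \<le> 2 ^ height t"
      using size1_height[of t] by (simp add: trees_of_size_def)
    then show "log 2 (real n) \<le> real (height t)"
      using n by (intro log2_of_power_le) auto
  qed
  finally show ?thesis .
qed

text \<open>By the mean value theorem, the increment of \<open>f\<close> over a unit interval is a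
  value of \<open>f'\<close> to the right of the left endpoint; these increments telescope.\<close>

lemma sum_deriv_le_of_mono_deriv:
  fixes f f' :: "real \<Rightarrow> real"
  assumes deriv: "\<And>x. x \<ge> 1 \<Longrightarrow> (f has_real_derivative f' x) (at x)"
    and mono: "mono_on {1..} f'" and n: "n \<ge> 1"
  shows "(\<Sum>i=1..n-1. f' (real i)) \<le> f (real n) - f 1"
  using n
proof (induction n rule: dec_induct)
  case (step n)
  have "\<exists>x>real n. x < real n + 1 \<and> f (real n + 1) - f (real n) = (real n + 1 - real n) * f' x"
    using step.hyps by (intro MVT2 deriv) auto
  then obtain x where x: "x > real n" "f (real n + 1) - f (real n) = f' x" by auto
  have "f' (real n) \<le> f' x"
    using step.hyps x by (intro mono_onD[OF mono]) auto
  moreover have "(\<Sum>i=1..Suc n - 1. f' (real i)) = (\<Sum>i=1..n-1. f' (real i)) + f' (real n)"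
    using step.hyps by (cases n) auto
  ultimately show ?case using step.IH x by (simp add: add.commute)
qed simp

theorem theorem3p3:
  fixes \<psi> :: "nat \<Rightarrow> real" and N :: nat and \<sigma> :: "nat \<Rightarrow> nat \<Rightarrow> real"
    and \<theta> \<theta>' :: "real \<Rightarrow> real"
  assumes "\<And>n. n \<ge> 1 \<Longrightarrow> \<psi> n \<in> {0<..1}"
    and "antimono_on {1..} \<psi>"
    and "N \<ge> 1"
    and "\<sigma> \<in> upper_bounded_sources \<psi> N"
    and "\<And>x. x > 0 \<Longrightarrow> (\<theta> has_real_derivative \<theta>' x) (at x)"
    and "\<And>x. x > 0 \<Longrightarrow> \<theta> x \<ge> 0"
    and "\<not> \<theta>' constant_on {0<..}"
    and "mono_on {1..} \<theta>'"
    and "\<And>n::nat. n \<ge> N \<Longrightarrow> exp 1 * \<psi> n * \<theta> (real n) \<le> \<theta>' (real n)"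
    and "\<theta>' 1 \<ge> 1"
  shows "\<exists>\<epsilon> :: nat \<Rightarrow> real. \<epsilon> \<longlonglongrightarrow> 0 \<and>
    (\<forall>\<^sub>F n in sequentially. expected_height \<sigma> n \<le> ln (\<theta>' (real n)) * (1 + \<epsilon> n))"
proof -
  note deriv = assms(5) and nonneg = assms(6) and mono = assms(8) and bound = assms(9)
  have \<sigma>: "\<sigma> \<in> leaf_centric_sources"
    and \<psi>: "\<And>n i. n \<ge> N \<Longrightarrow> i \<in> {1..n-1} \<Longrightarrow> \<sigma> i (n - i) + \<sigma> (n - i) i \<le> \<psi> n"
    using assms(4) by (auto simp: upper_bounded_sources_def)
  define F where "F = expected_leaf_weight \<sigma> (exp 1)"
  have F_nonneg: "F n \<ge> 0" for n
    unfolding F_def by (intro expected_leaf_weight_nonneg \<sigma>) simp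
  have \<theta>'_ge_1: "\<theta>' (real n) \<ge> 1" if "n \<ge> 1" for n
    using mono_onD[OF mono, of 1 "real n"] that assms(10) by auto
  \<comment> \<open>The sum dominates \<open>F\<close> at all sizes up to \<open>N\<close>, where
    \<open>\<psi>\<close> may give no control; the summand 1 keeps \<open>C\<close> positive, as
    \<open>ln C\<close> requires.\<close>
  define C where "C = 1 + (\<Sum>i\<le>N. F i)"
  have C: "C \<ge> 1" using F_nonneg by (simp add: C_def sum_nonneg)
  have F_le: "F n \<le> C * \<theta>' (real n)" if "n \<ge> 1" for n
    using that
  proof (induction n rule: less_induct)
    case (less n)
    show ?case
    \<comment> \<open>The recursion needs \<open>n \<ge> 2\<close>; the remaining size 1 is at most
      \<open>N\<close>.\<close>
    proof (cases "n \<le> N \<or> n < 2")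
      case True
      then have "n \<le> N" using less.prems \<open>N \<ge> 1\<close> by auto
      then have "F n \<le> (\<Sum>i\<le>N. F i)" using F_nonneg by (intro member_le_sum) auto
      then have "F n \<le> C" by (simp add: C_def)
      also have "C * 1 \<le> C * \<theta>' (real n)"
        using C \<theta>'_ge_1[OF less.prems] by (intro mult_left_mono) auto
      finally show ?thesis by simp
    next
      case False
      have "F n = exp 1 * (\<Sum>i=1..n-1. (\<sigma> i (n - i) + \<sigma> (n - i) i) * F i)"
        using False unfolding F_def by (intro expected_leaf_weight_rec \<sigma>) auto
      also have "\<dots> \<le> exp 1 * (\<Sum>i=1..n-1. \<psi> n * (C * \<theta>' (real i)))"
      proof (intro mult_left_mono sum_mono)
        fix i assume i: "i \<in> {1..n-1}"
        then have "F i \<le> C * \<theta>' (real i)" by (intro less.IH) auto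
        then show "(\<sigma> i (n - i) + \<sigma> (n - i) i) * F i \<le> \<psi> n * (C * \<theta>' (real i))"
          using i False assms(1)[of n] by (intro mult_mono \<psi> F_nonneg) auto
      qed simp
      also have "\<dots> = exp 1 * \<psi> n * C * (\<Sum>i=1..n-1. \<theta>' (real i))"
        by (simp add: sum_distrib_left mult_ac)
      also have "\<dots> \<le> exp 1 * \<psi> n * C * \<theta> (real n)"
      proof (rule mult_left_mono)
        \<comment> \<open>The term \<open>- \<theta> 1\<close> from the telescoped bound is dropped,
          since \<open>\<theta> 1 \<ge> 0\<close>.\<close>
        show "(\<Sum>i=1..n-1. \<theta>' (real i)) \<le> \<theta> (real n)"
          using sum_deriv_le_of_mono_deriv[of \<theta> \<theta>' n] deriv mono less.prems nonneg[of 1] by simp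
      qed (use C assms(1)[of n] less.prems in auto)
      also have "\<dots> = C * (exp 1 * \<psi> n * \<theta> (real n))" by simp
      also have "\<dots> \<le> C * \<theta>' (real n)"
        using False C by (intro mult_left_mono bound) auto
      finally show ?thesis .
    qed
  qed
  have height_le: "expected_height \<sigma> n \<le> ln (\<theta>' (real n)) + ln C" if n: "n \<ge> 1" for n
  proof -
    have "exp (expected_height \<sigma> n) \<le> C * \<theta>' (real n)"
      using exp_expected_height_le[OF \<sigma> n] F_le[OF n] by (simp add: F_def)
    then have "expected_height \<sigma> n \<le> ln (C * \<theta>' (real n))"
      using C \<theta>'_ge_1[OF n] by (subst ln_ge_iff) auto
    also have "\<dots> = ln (\<theta>' (real n)) + ln C"
      using C \<theta>'_ge_1[OF n] by (subst ln_mult) auto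
    finally show ?thesis .
  qed
  \<comment> \<open>The expected height lies between \<open>log 2 n\<close> and
    \<open>ln (\<theta>' n) + ln C\<close>, which forces \<open>ln (\<theta>' n)\<close> to
    diverge.\<close>
  have lim: "filterlim (\<lambda>n. ln (\<theta>' (real n))) at_top sequentially"
  proof (rule filterlim_at_top_mono)
    have "filterlim (\<lambda>n. - ln C + 1 / ln 2 * ln (real n)) at_top sequentially"
      by (intro filterlim_tendsto_add_at_top[OF tendsto_const]
          filterlim_tendsto_pos_mult_at_top[OF tendsto_const]
          filterlim_compose[OF ln_at_top filterlim_real_sequentially]) simp
    then show "filterlim (\<lambda>n. log 2 (real n) - ln C) at_top sequentially"
      by (simp add: log_def)
    show "\<forall>\<^sub>F n in sequentially. log 2 (real n) - ln C \<le> ln (\<theta>' (real n))"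
      using eventually_ge_at_top[of 1]
    proof eventually_elim
      case (elim n)
      then show ?case using log2_le_expected_height[OF \<sigma>, of n] height_le[of n] by simp
    qed
  qed
  show ?thesis
  proof (intro exI conjI)
    \<comment> \<open>This choice makes the error term exactly \<open>ln C\<close> once
      \<open>ln (\<theta>' n)\<close> is positive.\<close>
    show "(\<lambda>n. ln C / ln (\<theta>' (real n))) \<longlonglongrightarrow> 0"
      by (rule tendsto_divide_0[OF tendsto_const filterlim_at_top_imp_at_infinity[OF lim]])
    show "\<forall>\<^sub>F n in sequentially.
        expected_height \<sigma> n \<le> ln (\<theta>' (real n)) * (1 + ln C / ln (\<theta>' (real n)))"
      using eventually_ge_at_top[of 1] filterlim_at_top_dense[THEN iffD1, OF lim, rule_format, of 0]
    proof eventually_elim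
      case (elim n)
      then show ?case using height_le[of n] by (simp add: distrib_left)
    qed
  qed
qed

end
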